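(* Let $\mathcal{A}\in\mathbb{C}^{I(N)\times I(N)}$ with $\mathrm{ind}(\mathcal{A})=k$. Then $\mathcal{A}$ has a unique core-EP inverse in $\mathbb{C}^{I(N)\times I(N)}$.
   Context: Let $I_1,\dots,I_N$ be positive integers. $\mathbb{C}^{I(N)\times I(N)}$ denotes the set of complex tensors of order $2N$ with entries $\mathcal{A}_{i_1\dots i_N j_1\dots j_N}$, where $1\le i_k,j_k\le I_k$. The Einstein product is $(\mathcal{A}*_N\mathcal{B})_{i_1\dots i_N j_1\dots j_N}=\sum_{k_1,\dots,k_N}\mathcal{A}_{i_1\dots i_N k_1\dots k_N}\mathcal{B}_{k_1\dots k_N j_1\dots j_N}$, and powers $\mathcal{A}^p$ are taken with respect to $*_N$. For $\mathcal{Z}\in\mathbb{C}^{I_1\times\cdots\times I_N}$, $(\mathcal{A}*_N\mathcal{Z})_{i_1\dots i_N}=\sum_{k_1,\dots,k_N}\mathcal{A}_{i_1\dots i_N k_1\dots k_N}\mathcal{Z}_{k_1\dots k_N}$, and the range is $\mathfrak{R}(\mathcal{A})=\{\mathcal{A}*_N\mathcal{Z}:\mathcal{Z}\in\mathbb{C}^{I_1\times\cdots\times I_N}\}$. The conjugate transpose $\mathcal{A}^*$ is defined by $(\mathcal{A}^* )_{j_1\dots j_N i_1\dots i_N}=\overline{\mathcal{A}_{i_1\dots i_N j_1\dots j_N}}$. The index $\mathrm{ind}(\mathcal{A})$ is the smallest positive integer $k$ such that $\mathfrak{R}(\mathcal{A}^k)=\mathfrak{R}(\mathcal{A}^{k+1})$.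 If $\mathrm{ind}(\mathcal{A})=k$, a core-EP inverse of $\mathcal{A}$ is a tensor $\mathcal{X}\in\mathbb{C}^{I(N)\times I(N)}$ satisfying $\mathcal{X}*_N\mathcal{A}^{k+1}=\mathcal{A}^k$, $\mathcal{A}*_N\mathcal{X}^2=\mathcal{X}$, and $(\mathcal{A}*_N\mathcal{X})^*=\mathcal{A}*_N\mathcal{X}$. *)

theory Defs
  imports Complex_Main "HOL-Library.FuncSet"
begin

text \<open>
  A multi-index (i_1, ..., i_N) is an extensional function on {1..N}. Tensors are extensional
  functions of multi-indices, so that HOL equality of two tensors of the same shape is equality of
  all entries. A tensor of order 2N is curried: its entry at (i_1, ..., i_N, j_1, ..., j_N) is
  A i j.
\<close>

definition multi_index :: "nat \<Rightarrow> (nat \<Rightarrow> nat) \<Rightarrow> (nat \<Rightarrow> nat) set" where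
  "multi_index N I = (\<Pi>\<^sub>E m\<in>{1..N}. {1..I m})"

type_synonym tensor = "(nat \<Rightarrow> nat) \<Rightarrow> complex"
type_synonym tensor2 = "(nat \<Rightarrow> nat) \<Rightarrow> (nat \<Rightarrow> nat) \<Rightarrow> complex"

definition tensors :: "nat \<Rightarrow> (nat \<Rightarrow> nat) \<Rightarrow> tensor set" where
  "tensors N I = (multi_index N I \<rightarrow>\<^sub>E UNIV)"

definition square_tensors :: "nat \<Rightarrow> (nat \<Rightarrow> nat) \<Rightarrow> tensor2 set" where
  "square_tensors N I = (multi_index N I \<rightarrow>\<^sub>E tensors N I)"

definition einstein_prod :: "nat \<Rightarrow> (nat \<Rightarrow> nat) \<Rightarrow> tensor2 \<Rightarrow> tensor2 \<Rightarrow> tensor2" where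
  "einstein_prod N I A B =
     (\<lambda>i\<in>multi_index N I. \<lambda>j\<in>multi_index N I. \<Sum>k\<in>multi_index N I. A i k * B k j)"

definition tensor_app :: "nat \<Rightarrow> (nat \<Rightarrow> nat) \<Rightarrow> tensor2 \<Rightarrow> tensor \<Rightarrow> tensor" where
  "tensor_app N I A Z = (\<lambda>i\<in>multi_index N I. \<Sum>k\<in>multi_index N I. A i k * Z k)"

definition id_tensor :: "nat \<Rightarrow> (nat \<Rightarrow> nat) \<Rightarrow> tensor2" where
  "id_tensor N I = (\<lambda>i\<in>multi_index N I. \<lambda>j\<in>multi_index N I. if i = j then 1 else 0)"

primrec tensor_pow :: "nat \<Rightarrow> (nat \<Rightarrow> nat) \<Rightarrow> tensor2 \<Rightarrow> nat \<Rightarrow> tensor2" where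
  "tensor_pow N I A 0 = id_tensor N I"
| "tensor_pow N I A (Suc p) = einstein_prod N I (tensor_pow N I A p) A"

definition tensor_range :: "nat \<Rightarrow> (nat \<Rightarrow> nat) \<Rightarrow> tensor2 \<Rightarrow> tensor set" where
  "tensor_range N I A = {tensor_app N I A Z | Z. Z \<in> tensors N I}"

definition conj_transpose :: "nat \<Rightarrow> (nat \<Rightarrow> nat) \<Rightarrow> tensor2 \<Rightarrow> tensor2" where
  "conj_transpose N I A = (\<lambda>j\<in>multi_index N I. \<lambda>i\<in>multi_index N I. cnj (A i j))"

text \<open>
  The ranges of the powers of A form a descending chain of subspaces of a finite-dimensional
  space, so the minimum below is always attained.
\<close>

definition tensor_ind :: "nat \<Rightarrow> (nat \<Rightarrow> nat) \<Rightarrow> tensor2 \<Rightarrow> nat" where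
  "tensor_ind N I A =
     (LEAST k. 0 < k \<and>
        tensor_range N I (tensor_pow N I A k) = tensor_range N I (tensor_pow N I A (k + 1)))"

definition core_EP_inverse :: "nat \<Rightarrow> (nat \<Rightarrow> nat) \<Rightarrow> tensor2 \<Rightarrow> tensor2 \<Rightarrow> bool" where
  "core_EP_inverse N I A X \<longleftrightarrow>
     (let k = tensor_ind N I A in
        X \<in> square_tensors N I \<and>
        einstein_prod N I X (tensor_pow N I A (k + 1)) = tensor_pow N I A k \<and>
        einstein_prod N I A (tensor_pow N I X 2) = X \<and>
        conj_transpose N I (einstein_prod N I A X) = einstein_prod N I A X)"

end

theory Submission
  imports Defs "HOL-Algebra.Group"
begin

text \<open>
  Linear dependence of the powers of a square tensor \<open>A\<close> gives \<open>A\<^sup>m = A\<^sup>m\<^sup>+\<^sup>1 Q = Q A\<^sup>m\<^sup>+\<^sup>1\<close> for some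
  \<open>m\<close> and \<open>Q\<close>. Hence the index exists, and \<open>A\<^sup>k\<close> is both a right and a left multiple of
  \<open>A\<^sup>k\<^sup>+\<^sup>1\<close>. Applied to \<open>B\<^sup>* B\<close>, where \<open>B\<^sup>* B C = B\<^sup>* B D\<close> implies \<open>B C = B D\<close>, the same fact gives
  \<open>W\<close> with \<open>B W B = B\<close> and \<open>B W\<close> Hermitian. For \<open>B = A\<^sup>k\<^sup>+\<^sup>1\<close> the tensor \<open>A\<^sup>k W\<close> is a core-EP
  inverse. Conversely, for any core-EP inverse \<open>X\<close> the product \<open>A X\<close> is the orthogonal projector
  onto the range of \<open>A\<^sup>k\<close>, and \<open>A X\<close> determines \<open>X\<close> since \<open>X A Y = Y\<close> for all core-EP inverses
  \<open>X\<close> and \<open>Y\<close>.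
\<close>

section \<open>Core-EP inverses in monoids with involution\<close>

locale star_monoid = monoid G for G (structure) +
  fixes star :: "'a \<Rightarrow> 'a"
  assumes star_closed [simp, intro]: "x \<in> carrier G \<Longrightarrow> star x \<in> carrier G"
    and star_star [simp]: "x \<in> carrier G \<Longrightarrow> star (star x) = x"
    and star_mult: "x \<in> carrier G \<Longrightarrow> y \<in> carrier G \<Longrightarrow> star (x \<otimes> y) = star y \<otimes> star x"
begin

text \<open>The exponent \<open>k\<close> is a free parameter here; the index takes its place when
  the monoid is specialised to tensors.\<close>

definition core_EP :: "nat \<Rightarrow> 'a \<Rightarrow> 'a \<Rightarrow> bool" where
  "core_EP k x y \<longleftrightarrow> y \<in> carrier G \<and> y \<otimes> x [^] Suc k = x [^] k \<and> x \<otimes> (y \<otimes> y) = y \<and>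
     star (x \<otimes> y) = x \<otimes> y"

text \<open>The identity is substituted into itself \<open>n\<close> times; it lets arbitrarily high
  powers of \<open>x\<close> be split off from \<open>x [^] k\<close>.\<close>

lemma pow_eq_pow_mult:
  assumes "x \<in> carrier G" "y \<in> carrier G" "x [^] k = x [^] Suc k \<otimes> y"
  shows "x [^] k = x [^] (k + n) \<otimes> y [^] (n::nat)"
proof (induction n)
  case (Suc n)
  have "x [^] k = x [^] n \<otimes> x [^] k \<otimes> y [^] n"
    unfolding nat_pow_mult[OF assms(1)] using Suc by (simp add: add.commute)
  also have "\<dots> = x [^] n \<otimes> (x [^] Suc k \<otimes> y) \<otimes> y [^] n"
    unfolding assms(3)[symmetric] ..
  also have "\<dots> = (x [^] n \<otimes> x [^] Suc k) \<otimes> (y \<otimes> y [^] n)"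
    using assms(1,2) by (simp add: m_assoc)
  also have "\<dots> = x [^] (k + Suc n) \<otimes> y [^] Suc n"
    unfolding nat_pow_Suc2[OF assms(2), symmetric] nat_pow_mult[OF assms(1)]
    by (simp add: add.commute)
  finally show ?case .
qed (use assms(1) in simp)

text \<open>Iterating \<open>y = x \<otimes> (y \<otimes> y)\<close> puts \<open>y\<close> into the
  right ideal generated by each power of \<open>x\<close>.\<close>

lemma mult_square_eq_imp_pow_mult:
  assumes "x \<in> carrier G" "y \<in> carrier G" "x \<otimes> (y \<otimes> y) = y"
  shows "x [^] n \<otimes> y [^] Suc n = y"
proof (induction n)
  case (Suc n)
  have "x [^] Suc n \<otimes> y [^] Suc (Suc n) = x [^] n \<otimes> (x \<otimes> (y \<otimes> y)) \<otimes> y [^] n"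
    unfolding nat_pow_Suc2[OF assms(2)] using assms(1,2) by (simp add: m_assoc)
  also have "\<dots> = x [^] n \<otimes> y [^] Suc n"
    unfolding assms(3) nat_pow_Suc2[OF assms(2)] using assms(1,2) by (simp add: m_assoc)
  finally show ?case using Suc by simp
qed (use assms in simp)

text \<open>\<open>x \<otimes> y\<close> and \<open>x \<otimes> z\<close> are selfadjoint
  idempotents, each absorbing the other from the left; such idempotents coincide.\<close>

lemma core_EP_unique:
  assumes x: "x \<in> carrier G" and w: "w \<in> carrier G" "x [^] k = x [^] Suc k \<otimes> w"
    and "core_EP k x y" "core_EP k x z"
  shows "y = z"
proof -
  \<comment> \<open>Once \<open>u\<close> is written as
    \<open>x [^] k \<otimes> u [^] Suc k\<close>, left multiplication by \<open>v\<close> lowers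
    \<open>x [^] Suc k\<close> to \<open>x [^] k\<close>.\<close>
  have absorb: "v \<otimes> (x \<otimes> u) = u" if "core_EP k x v" "core_EP k x u" for u v
  proof -
    have u: "u \<in> carrier G" "x [^] k \<otimes> u [^] Suc k = u"
      and v: "v \<in> carrier G" "v \<otimes> x [^] Suc k = x [^] k"
      using that x mult_square_eq_imp_pow_mult unfolding core_EP_def by blast+
    have "v \<otimes> (x \<otimes> u) = v \<otimes> (x \<otimes> (x [^] k \<otimes> u [^] Suc k))"
      using u by simp
    also have "\<dots> = v \<otimes> x [^] Suc k \<otimes> u [^] Suc k"
      unfolding nat_pow_Suc2[OF x] using x u(1) v(1) by (simp add: m_assoc)
    finally show ?thesis using u v by simp
  qed
  have proj: "x \<otimes> v \<otimes> (x \<otimes> u) = x \<otimes> u" if "core_EP k x v" "core_EP k x u" for u v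
    using absorb[OF that] that x by (simp add: core_EP_def m_assoc)
  have yz: "y \<in> carrier G" "z \<in> carrier G" "star (x \<otimes> y) = x \<otimes> y" "star (x \<otimes> z) = x \<otimes> z"
    using assms(4,5) by (auto simp: core_EP_def)
  \<comment> \<open>\<open>star\<close> reverses the order of the two projections, and
    \<open>proj\<close> evaluates the reversed product as \<open>x \<otimes> z\<close>.\<close>
  have "x \<otimes> y = star (x \<otimes> z \<otimes> (x \<otimes> y))"
    using proj[OF assms(5,4)] yz by simp
  also have "\<dots> = x \<otimes> y \<otimes> (x \<otimes> z)"
    using x yz by (simp add: star_mult[of "x \<otimes> z" "x \<otimes> y"])
  finally have "x \<otimes> y = x \<otimes> z"
    using proj[OF assms(4,5)] by simp
  then show ?thesis
    using absorb[OF assms(4,4)] absorb[OF assms(4,5)] by metis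
qed

end

text \<open>\<open>star_cancel\<close> is the subtraction-free form of
  "\<open>B\<^sup>* B v = 0\<close> implies \<open>B v = 0\<close>". \<open>strongly_regular\<close>
  is strong pi-regularity, with one \<open>q\<close> serving both sides.\<close>

locale strongly_regular_star_monoid = star_monoid +
  assumes star_cancel: "\<lbrakk>b \<in> carrier G; c \<in> carrier G; d \<in> carrier G;
      star b \<otimes> (b \<otimes> c) = star b \<otimes> (b \<otimes> d)\<rbrakk> \<Longrightarrow> b \<otimes> c = b \<otimes> d"
    and strongly_regular: "x \<in> carrier G \<Longrightarrow>
      \<exists>m. \<exists>q\<in>carrier G. x [^] m = x [^] Suc m \<otimes> q \<and> x [^] m = q \<otimes> x [^] Suc m"
begin

text \<open>The exponent \<open>m\<close> from \<open>strongly_regular\<close> may exceed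
  \<open>k\<close>. Writing \<open>x [^] k\<close> with a left factor \<open>x [^] m\<close> lets
  that factor become \<open>q \<otimes> x [^] Suc m\<close>; what follows
  \<open>q \<otimes> x\<close> folds back to \<open>x [^] k\<close>.\<close>

lemma left_multiple_of_right_multiple:
  assumes x: "x \<in> carrier G" and y: "y \<in> carrier G" "x [^] k = x [^] Suc k \<otimes> y"
  shows "\<exists>z\<in>carrier G. x [^] k = z \<otimes> x [^] Suc k"
proof -
  obtain m q where q: "q \<in> carrier G" "x [^] m = q \<otimes> x [^] Suc m"
    using strongly_regular[OF x] by blast
  have eq: "x [^] k = x [^] m \<otimes> (x [^] k \<otimes> y [^] m)"
    using pow_eq_pow_mult[OF x y, of m] x y(1) by (simp add: nat_pow_mult[symmetric] m_assoc[symmetric]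
      nat_pow_comm del: nat_pow_Suc Group.nat_pow_Suc)
  also have "\<dots> = q \<otimes> (x \<otimes> (x [^] m \<otimes> (x [^] k \<otimes> y [^] m)))"
    using q(1) x y(1) by (subst q(2), subst nat_pow_Suc2[OF x]) (simp add: m_assoc)
  also have "\<dots> = q \<otimes> x [^] Suc k"
    by (simp only: eq[symmetric] nat_pow_Suc2[OF x])
  finally show ?thesis using q(1) by blast
qed

text \<open>Cancellation lowers the exponent in \<open>strongly_regular\<close> to 1, so
  \<open>h = h \<otimes> (h \<otimes> q)\<close>. Comparing this with its adjoint gives
  \<open>h \<otimes> q = star q \<otimes> h\<close>.\<close>

lemma selfadjoint_regular:
  assumes h: "h \<in> carrier G" "star h = h"
  shows "\<exists>q\<in>carrier G. h = h \<otimes> (q \<otimes> h)"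
proof -
  obtain m q where q: "q \<in> carrier G" and m: "h [^] m = h [^] Suc m \<otimes> q"
    using strongly_regular[OF h(1)] by blast
  \<comment> \<open>The extra factor \<open>h\<close> guarantees a positive exponent, so that the
    descent below can stop at 1.\<close>
  have "h [^] Suc m = h \<otimes> (h [^] Suc m \<otimes> q)"
    unfolding m[symmetric] by (rule nat_pow_Suc2[OF h(1)])
  also have "\<dots> = h [^] Suc (Suc m) \<otimes> q"
    unfolding nat_pow_Suc2[OF h(1), of "Suc m"] using h(1) q by (simp add: m_assoc)
  finally have "h = h \<otimes> (h \<otimes> q)"
  proof (induction m)
    case 0
    then show ?case using h(1) q by (simp add: m_assoc)
  next
    case (Suc m)
    \<comment> \<open>As \<open>star h = h\<close>, the leading \<open>h\<close> can be read as
      \<open>star h\<close> and cancelled.\<close>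
    have "star h \<otimes> (h \<otimes> h [^] m) = star h \<otimes> (h \<otimes> (h [^] Suc m \<otimes> q))"
      using Suc.prems h q
      by (simp add: nat_pow_Suc2[OF h(1)] m_assoc del: nat_pow_Suc Group.nat_pow_Suc)
    then have "h \<otimes> h [^] m = h \<otimes> (h [^] Suc m \<otimes> q)"
      using h q by (intro star_cancel[OF h(1)]) auto
    then have "h [^] Suc m = h \<otimes> (h [^] Suc m \<otimes> q)"
      unfolding nat_pow_Suc2[OF h(1), of m] .
    also have "\<dots> = h [^] Suc (Suc m) \<otimes> q"
      unfolding nat_pow_Suc2[OF h(1), of "Suc m"] using h(1) q by (simp add: m_assoc)
    finally have "h [^] Suc m = h [^] Suc (Suc m) \<otimes> q" .
    then show ?case by (rule Suc.IH)
  qed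
  then have hq: "h \<otimes> (h \<otimes> q) = h" ..
  have qh: "star q \<otimes> (h \<otimes> h) = h"
    using arg_cong[OF hq, of star] h q by (simp add: star_mult m_assoc)
  have "h \<otimes> q = star q \<otimes> (h \<otimes> h) \<otimes> q"
    unfolding qh ..
  also have "\<dots> = star q \<otimes> h"
    using h q hq by (simp add: m_assoc)
  finally have "h = h \<otimes> (star q \<otimes> h)"
    using hq by simp
  then show ?thesis using q by blast
qed

text \<open>Such a \<open>w\<close> is a {1,3}-inverse of \<open>b\<close>. It comes from the
  least-squares formula: an inner inverse \<open>q\<close> of \<open>star b \<otimes> b\<close>,
  times \<open>star b\<close>.\<close>

lemma selfadjoint_inner_inverse:
  assumes b: "b \<in> carrier G"
  shows "\<exists>w\<in>carrier G. b \<otimes> (w \<otimes> b) = b \<and> star (b \<otimes> w) = b \<otimes> w"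
proof -
  have "star (star b \<otimes> b) = star b \<otimes> b"
    using b by (simp add: star_mult)
  then obtain q where q: "q \<in> carrier G"
    and h: "star b \<otimes> b = star b \<otimes> b \<otimes> (q \<otimes> (star b \<otimes> b))"
    using selfadjoint_regular[of "star b \<otimes> b"] b by blast
  define w where "w = q \<otimes> star b"
  have w: "w \<in> carrier G" using b q by (simp add: w_def)
  have "b \<otimes> \<one> = b \<otimes> (q \<otimes> (star b \<otimes> b))"
    using b q h by (intro star_cancel[OF b]) (simp_all add: m_assoc)
  then have bwb: "b \<otimes> (w \<otimes> b) = b"
    using b q by (simp add: w_def m_assoc)
  \<comment> \<open>Selfadjointness follows by showing that \<open>b \<otimes> w\<close> has the
    form \<open>p \<otimes> star p\<close>, with \<open>p\<close> being \<open>b \<otimes> w\<close>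
    itself.\<close>
  have "b \<otimes> w \<otimes> star (b \<otimes> w) = b \<otimes> q \<otimes> star (b \<otimes> w \<otimes> b)"
    using b q w by (simp add: w_def star_mult m_assoc)
  also have "\<dots> = b \<otimes> w"
    using b q w bwb by (simp add: w_def m_assoc)
  finally have p: "b \<otimes> w \<otimes> star (b \<otimes> w) = b \<otimes> w" .
  have "star (b \<otimes> w) = star (b \<otimes> w \<otimes> star (b \<otimes> w))"
    using p by simp
  also have "\<dots> = b \<otimes> w"
    using b w by (subst star_mult) (simp_all add: p)
  finally show ?thesis using bwb w by blast
qed

lemma core_EP_exists:
  assumes x: "x \<in> carrier G" and y: "y \<in> carrier G" "x [^] k = x [^] Suc k \<otimes> y"
  shows "\<exists>z. core_EP k x z"
proof -
  define b where "b = x [^] Suc k"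
  have b: "b \<in> carrier G" using x by (simp add: b_def)
  obtain w where w: "w \<in> carrier G" "b \<otimes> (w \<otimes> b) = b" "star (b \<otimes> w) = b \<otimes> w"
    using selfadjoint_inner_inverse[OF b] by blast
  obtain v where v: "v \<in> carrier G" "x [^] k = v \<otimes> b"
    using left_multiple_of_right_multiple[OF x y] by (auto simp: b_def)
  \<comment> \<open>Chosen so that \<open>x \<otimes> z\<close> is the selfadjoint
    \<open>b \<otimes> w\<close>. The left multiple \<open>v \<otimes> b\<close> then gives
    \<open>z \<otimes> b = x [^] k\<close>, and the right multiple \<open>b \<otimes> y\<close>
    gives \<open>x \<otimes> (z \<otimes> z) = z\<close>.\<close>
  define z where "z = x [^] k \<otimes> w"
  have z: "z \<in> carrier G" using x w by (simp add: z_def)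
  have xz: "x \<otimes> z = b \<otimes> w"
    unfolding z_def b_def nat_pow_Suc2[OF x] using x w by (simp add: m_assoc)
  have "z \<otimes> b = v \<otimes> (b \<otimes> (w \<otimes> b))"
    using b v(1) w(1) by (simp add: z_def v(2) m_assoc)
  then have zb: "z \<otimes> b = x [^] k"
    using w v by simp
  have "x \<otimes> (z \<otimes> z) = b \<otimes> w \<otimes> z"
    using x z xz by (simp add: m_assoc[symmetric])
  also have "\<dots> = b \<otimes> (w \<otimes> b) \<otimes> (y \<otimes> w)"
    unfolding z_def y(2) b_def[symmetric] using b w(1) y(1) by (simp add: m_assoc)
  also have "\<dots> = z"
    unfolding w(2) z_def y(2) b_def[symmetric] using b w(1) y(1) by (simp add: m_assoc)
  finally have "core_EP k x z"
    using z zb xz w(3) unfolding core_EP_def b_def by simp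
  then show ?thesis ..
qed

end

section \<open>Square tensors\<close>

lemma finite_multi_index [simp]: "finite (multi_index N I)"
  by (simp add: multi_index_def finite_PiE)

lemma square_tensors_eqI:
  assumes "A \<in> square_tensors N I" "B \<in> square_tensors N I"
    and "\<And>i j. i \<in> multi_index N I \<Longrightarrow> j \<in> multi_index N I \<Longrightarrow> A i j = B i j"
  shows "A = B"
proof (rule PiE_ext[OF assms(1,2)[unfolded square_tensors_def]])
  fix i assume i: "i \<in> multi_index N I"
  then have "A i \<in> tensors N I" "B i \<in> tensors N I"
    using assms(1,2) by (auto simp: square_tensors_def)
  then show "A i = B i"
    unfolding tensors_def by (rule PiE_ext) (use assms(3) i in auto)
qed

lemma restrict_in_square_tensors [simp, intro]:
  "(\<lambda>i\<in>multi_index N I. \<lambda>j\<in>multi_index N I. f i j) \<in> square_tensors N I"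
  by (auto simp: square_tensors_def tensors_def)

lemma einstein_prod_closed [simp, intro]: "einstein_prod N I A B \<in> square_tensors N I"
  by (simp add: einstein_prod_def)

lemma id_tensor_closed [simp, intro]: "id_tensor N I \<in> square_tensors N I"
  by (simp add: id_tensor_def)

lemma conj_transpose_closed [simp, intro]: "conj_transpose N I A \<in> square_tensors N I"
  by (simp add: conj_transpose_def)

lemma tensor_pow_closed [simp, intro]: "tensor_pow N I A p \<in> square_tensors N I"
  by (cases p) auto

lemma einstein_prod_entry [simp]:
  "i \<in> multi_index N I \<Longrightarrow> j \<in> multi_index N I \<Longrightarrow>
    einstein_prod N I A B i j = (\<Sum>k\<in>multi_index N I. A i k * B k j)"
  by (simp add: einstein_prod_def)

lemma conj_transpose_entry [simp]:
  "i \<in> multi_index N I \<Longrightarrow> j \<in> multi_index N I \<Longrightarrow> conj_transpose N I A i j = cnj (A j i)"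
  by (simp add: conj_transpose_def)

lemma einstein_prod_assoc:
  "einstein_prod N I (einstein_prod N I A B) C = einstein_prod N I A (einstein_prod N I B C)"
proof (rule square_tensors_eqI[of _ N I]; simp?)
  fix i j
  have "(\<Sum>k\<in>multi_index N I. (\<Sum>l\<in>multi_index N I. A i l * B l k) * C k j) =
    (\<Sum>k\<in>multi_index N I. \<Sum>l\<in>multi_index N I. A i l * (B l k * C k j))"
    by (simp add: sum_distrib_right mult.assoc)
  also have "\<dots> = (\<Sum>l\<in>multi_index N I. A i l * (\<Sum>k\<in>multi_index N I. B l k * C k j))"
    by (subst sum.swap) (simp add: sum_distrib_left)
  finally show "(\<Sum>k\<in>multi_index N I. (\<Sum>l\<in>multi_index N I. A i l * B l k) * C k j) = \<dots>" .
qed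

lemma id_tensor_mult:
  "A \<in> square_tensors N I \<Longrightarrow> einstein_prod N I (id_tensor N I) A = A"
  by (rule square_tensors_eqI[of _ N I]) (simp_all add: id_tensor_def if_distrib[of "\<lambda>x. x * _"] cong: if_cong)

lemma mult_id_tensor:
  "A \<in> square_tensors N I \<Longrightarrow> einstein_prod N I A (id_tensor N I) = A"
  by (rule square_tensors_eqI[of _ N I]) (simp_all add: id_tensor_def if_distrib[of "\<lambda>x. _ * x"] cong: if_cong)

section \<open>The star monoid of square tensors and its strong regularity\<close>

definition tensor_monoid :: "nat \<Rightarrow> (nat \<Rightarrow> nat) \<Rightarrow> tensor2 monoid" where
  "tensor_monoid N I =
     \<lparr>carrier = square_tensors N I, monoid.mult = einstein_prod N I, one = id_tensor N I\<rparr>"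

lemma tensor_monoid_simps [simp]:
  "carrier (tensor_monoid N I) = square_tensors N I"
  "mult (tensor_monoid N I) = einstein_prod N I"
  "one (tensor_monoid N I) = id_tensor N I"
  by (simp_all add: tensor_monoid_def)

lemma tensor_monoid_pow [simp]: "A [^]\<^bsub>tensor_monoid N I\<^esub> (p::nat) = tensor_pow N I A p"
  by (induction p) (simp_all add: nat_pow_def)

interpretation tensor_monoid: star_monoid "tensor_monoid N I" "conj_transpose N I" for N I
proof
  fix A B assume A: "A \<in> carrier (tensor_monoid N I)"
  show "conj_transpose N I (conj_transpose N I A) = A"
    using A by (intro square_tensors_eqI[of _ N I]) auto
  show "conj_transpose N I (A \<otimes>\<^bsub>tensor_monoid N I\<^esub> B) =
      conj_transpose N I B \<otimes>\<^bsub>tensor_monoid N I\<^esub> conj_transpose N I A"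
    by (intro square_tensors_eqI[of _ N I]) (auto simp: mult.commute)
qed (auto simp: einstein_prod_assoc id_tensor_mult mult_id_tensor)

lemma tensor_pow_add:
  "A \<in> square_tensors N I \<Longrightarrow>
    einstein_prod N I (tensor_pow N I A m) (tensor_pow N I A n) = tensor_pow N I A (m + n)"
  using tensor_monoid.nat_pow_mult[of A N I m n] by simp

text \<open>Column by column: if \<open>v = B E\<close> and \<open>B\<^sup>* v = 0\<close>, then the
  squared norm of \<open>v\<close> is \<open>E\<^sup>* B\<^sup>* v = 0\<close>.\<close>

lemma conj_transpose_mult_self_cancel:
  assumes B: "B \<in> square_tensors N I" "C \<in> square_tensors N I" "D \<in> square_tensors N I"
    and eq: "einstein_prod N I (conj_transpose N I B) (einstein_prod N I B C) =
      einstein_prod N I (conj_transpose N I B) (einstein_prod N I B D)"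
  shows "einstein_prod N I B C = einstein_prod N I B D"
proof (rule square_tensors_eqI)
  fix i j assume i: "i \<in> multi_index N I" and j: "j \<in> multi_index N I"
  let ?S = "multi_index N I"
  \<comment> \<open>\<open>E\<close> is column \<open>j\<close> of the difference of
    \<open>C\<close> and \<open>D\<close>, and \<open>v\<close> is its image under
    \<open>B\<close>.\<close>
  define E where "E k = C k j - D k j" for k
  define v where "v l = (\<Sum>k\<in>?S. B l k * E k)" for l
  have v: "v l = einstein_prod N I B C l j - einstein_prod N I B D l j" if "l \<in> ?S" for l
    using that j by (simp add: v_def E_def right_diff_distrib sum_subtractf)
  have orth: "(\<Sum>l\<in>?S. cnj (B l k) * v l) = 0" if k: "k \<in> ?S" for k
  proof -
    have "(\<Sum>l\<in>?S. cnj (B l k) * v l) =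
      einstein_prod N I (conj_transpose N I B) (einstein_prod N I B C) k j -
      einstein_prod N I (conj_transpose N I B) (einstein_prod N I B D) k j"
      using k j by (simp add: v right_diff_distrib sum_subtractf)
    then show ?thesis using eq by simp
  qed
  \<comment> \<open>Only the conjugated \<open>v l\<close> is expanded, which moves \<open>B\<close>
    over to the other factor, where \<open>orth\<close> applies.\<close>
  have "(\<Sum>l\<in>?S. cnj (v l) * v l) = (\<Sum>l\<in>?S. \<Sum>k\<in>?S. cnj (E k) * (cnj (B l k) * v l))"
    by (subst (1) v_def) (simp add: sum_distrib_right sum_distrib_left mult_ac)
  also have "\<dots> = (\<Sum>k\<in>?S. cnj (E k) * (\<Sum>l\<in>?S. cnj (B l k) * v l))"
    by (subst sum.swap) (simp add: sum_distrib_left)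
  also have "\<dots> = 0" using orth by simp
  finally have "complex_of_real (\<Sum>l\<in>?S. (cmod (v l))\<^sup>2) = 0"
    by (simp add: complex_norm_square mult.commute del: of_real_power)
  then have "(\<Sum>l\<in>?S. (cmod (v l))\<^sup>2) = 0"
    using of_real_eq_0_iff by blast
  then have "v i = 0"
    using i by (simp add: sum_nonneg_eq_0_iff)
  then show "einstein_prod N I B C i j = einstein_prod N I B D i j"
    using v[OF i] by simp
qed auto

text \<open>Gaussian elimination, by induction on the equations: a new equation either vanishes
  identically or supplies a pivot \<open>p\<close> that removes one unknown.\<close>

lemma underdetermined_system_has_nonzero_solution:
  fixes a :: "'e \<Rightarrow> 'v \<Rightarrow> 'f::field"
  assumes "finite E" "finite V" "card E < card V"
  shows "\<exists>c. (\<exists>v\<in>V. c v \<noteq> 0) \<and> (\<forall>e\<in>E. (\<Sum>v\<in>V. a e v * c v) = 0)"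
  using assms
proof (induction E arbitrary: V a rule: finite_induct)
  case empty
  then show ?case by (intro exI[of _ "\<lambda>_. 1"]) (auto simp: card_gt_0_iff)
next
  case (insert e E)
  show ?case
  proof (cases "\<forall>v\<in>V. a e v = 0")
    case True
    then show ?thesis using insert.IH[of V a] insert by auto
  next
    case False
    then obtain p where p: "p \<in> V" "a e p \<noteq> 0" by blast
    \<comment> \<open>Coefficients of the remaining equations after eliminating \<open>p\<close> by
      means of equation \<open>e\<close>.\<close>
    define b where "b f v = a f v - a f p * a e v / a e p" for f v
    have "card E < card (V - {p})" "finite (V - {p})"
      using insert p by auto
    then obtain c where c: "\<exists>v\<in>V - {p}. c v \<noteq> 0" "\<And>f. f \<in> E \<Longrightarrow> (\<Sum>v\<in>V - {p}. b f v * c v) = 0"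
      using insert.IH[of "V - {p}" b] by blast
    define s where "s = (\<Sum>v\<in>V - {p}. a e v * c v)"
    \<comment> \<open>Back substitution: the value at \<open>p\<close> is the one that equation
      \<open>e\<close> forces.\<close>
    define d where "d = c(p := - s / a e p)"
    have sum_d: "(\<Sum>v\<in>V. a f v * d v) = (\<Sum>v\<in>V - {p}. a f v * c v) - a f p * s / a e p" for f
    proof -
      have "(\<Sum>v\<in>V. a f v * d v) = a f p * d p + (\<Sum>v\<in>V - {p}. a f v * d v)"
        using insert.prems p by (simp add: sum.remove)
      also have "(\<Sum>v\<in>V - {p}. a f v * d v) = (\<Sum>v\<in>V - {p}. a f v * c v)"
        by (rule sum.cong) (auto simp: d_def)
      finally show ?thesis by (simp add: d_def)
    qed
    have "(\<Sum>v\<in>V. a f v * d v) = (\<Sum>v\<in>V - {p}. b f v * c v)" for f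
      unfolding sum_d b_def s_def
      by (simp add: left_diff_distrib sum_subtractf sum_distrib_left sum_divide_distrib mult.assoc)
    then have "(\<Sum>v\<in>V. a f v * d v) = 0" if "f \<in> E" for f
      using c(2) that by simp
    moreover have "(\<Sum>v\<in>V. a e v * d v) = 0"
      unfolding sum_d using p by (simp add: s_def)
    moreover have "\<exists>v\<in>V. d v \<noteq> 0"
      using c(1) by (auto simp: d_def)
    ultimately show ?thesis by auto
  qed
qed

text \<open>Solve a linear dependence among the powers of \<open>A\<close> for its lowest term. As
  \<open>Q\<close> is a polynomial in \<open>A\<close>, the same \<open>Q\<close> works on both
  sides.\<close>

lemma tensor_pow_strongly_regular:
  assumes A: "A \<in> square_tensors N I"
  shows "\<exists>m. \<exists>Q\<in>square_tensors N I.
    tensor_pow N I A m = einstein_prod N I (tensor_pow N I A (Suc m)) Q \<and>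
    tensor_pow N I A m = einstein_prod N I Q (tensor_pow N I A (Suc m))"
proof -
  let ?S = "multi_index N I" and ?P = "tensor_pow N I A"
  define M where "M = card (?S \<times> ?S)"
  \<comment> \<open>One equation per entry and one unknown per exponent \<open>0..M\<close>:
    \<open>M\<close> equations in \<open>M + 1\<close> unknowns.\<close>
  obtain c where c: "\<exists>n\<le>M. c n \<noteq> 0"
    and dep: "\<And>i j. i \<in> ?S \<Longrightarrow> j \<in> ?S \<Longrightarrow> (\<Sum>n\<le>M. ?P n i j * c n) = 0"
    using underdetermined_system_has_nonzero_solution
      [of "?S \<times> ?S" "{..M}" "\<lambda>(i, j) n. ?P n i j"] by (auto simp: M_def)
  define m where "m = (LEAST n. n \<le> M \<and> c n \<noteq> 0)"
  have m: "m \<le> M" "c m \<noteq> 0"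
    using LeastI_ex[OF c[unfolded Bex_def]] by (auto simp: m_def)
  have below: "c n = 0" if "n < m" for n
    using that not_less_Least[of n "\<lambda>n. n \<le> M \<and> c n \<noteq> 0"] m(1) by (auto simp: m_def)
  \<comment> \<open>What remains of the dependence after division by \<open>- c m\<close> and
    removal of a factor \<open>A\<^sup>m\<^sup>+\<^sup>1\<close>; it is zero if
    \<open>m = M\<close>.\<close>
  define Q where "Q = (\<lambda>i\<in>?S. \<lambda>j\<in>?S. \<Sum>n<M - m. - c (Suc (m + n)) / c m * ?P n i j)"
  have Q: "Q \<in> square_tensors N I" by (simp add: Q_def)
  have key: "?P m i j = (\<Sum>n<M - m. - c (Suc (m + n)) / c m * ?P (Suc (m + n)) i j)"
    if "i \<in> ?S" "j \<in> ?S" for i j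
  proof -
    have "0 = (\<Sum>n\<in>{..<m} \<union> {m..M}. ?P n i j * c n)"
      using dep[OF that] m(1) by (simp add: ivl_disj_un)
    also have "\<dots> = (\<Sum>n=m..M. ?P n i j * c n)"
      by (subst sum.union_disjoint) (auto simp: below)
    also have "\<dots> = ?P m i j * c m + (\<Sum>n=Suc m..M. ?P n i j * c n)"
      using m(1) by (rule sum.atLeast_Suc_atMost)
    also have "(\<Sum>n=Suc m..M. ?P n i j * c n) =
        (\<Sum>n<M - m. ?P (Suc (m + n)) i j * c (Suc (m + n)))"
      by (rule sum.reindex_bij_witness[of _ "\<lambda>n. Suc (m + n)" "\<lambda>n. n - Suc m"]) auto
    finally have "?P m i j = - (\<Sum>n<M - m. ?P (Suc (m + n)) i j * c (Suc (m + n))) / c m"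
      using m(2) by (simp add: field_simps eq_neg_iff_add_eq_0)
    then show ?thesis
      by (simp add: sum_divide_distrib sum_negf mult.commute del: tensor_pow.simps)
  qed
  have entry: "(\<Sum>k\<in>?S. ?P p i k * ?P q k j) = ?P (p + q) i j" if "i \<in> ?S" "j \<in> ?S" for p q i j
    using that einstein_prod_entry[of i N I j "?P p" "?P q"] tensor_pow_add[OF A, of p q] by simp
  have "?P m = einstein_prod N I (?P (Suc m)) Q"
  proof (rule square_tensors_eqI)
    fix i j assume ij: "i \<in> ?S" "j \<in> ?S"
    have "einstein_prod N I (?P (Suc m)) Q i j =
      (\<Sum>n<M - m. - c (Suc (m + n)) / c m * (\<Sum>k\<in>?S. ?P (Suc m) i k * ?P n k j))"
      using ij by (simp add: Q_def sum_distrib_left mult.left_commute del: tensor_pow.simps)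
        (rule sum.swap)
    then show "?P m i j = einstein_prod N I (?P (Suc m)) Q i j"
      using ij by (simp add: entry key del: tensor_pow.simps)
  qed (use Q in auto)
  moreover have "?P m = einstein_prod N I Q (?P (Suc m))"
  proof (rule square_tensors_eqI)
    fix i j assume ij: "i \<in> ?S" "j \<in> ?S"
    have "einstein_prod N I Q (?P (Suc m)) i j =
      (\<Sum>n<M - m. - c (Suc (m + n)) / c m * (\<Sum>k\<in>?S. ?P n i k * ?P (Suc m) k j))"
      using ij by (simp add: Q_def sum_distrib_left sum_distrib_right mult.assoc del: tensor_pow.simps)
        (rule sum.swap)
    then show "?P m i j = einstein_prod N I Q (?P (Suc m)) i j"
      using ij by (simp add: entry key add.commute del: tensor_pow.simps)
  qed (use Q in auto)
  ultimately show ?thesis using Q by blast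
qed

interpretation tensor_monoid: strongly_regular_star_monoid "tensor_monoid N I" "conj_transpose N I"
  for N I
  by unfold_locales
    (unfold tensor_monoid_simps tensor_monoid_pow,
      (rule conj_transpose_mult_self_cancel tensor_pow_strongly_regular; assumption)+)

section \<open>Ranges and the index\<close>

lemma tensor_app_closed [simp, intro]: "tensor_app N I A Z \<in> tensors N I"
  by (auto simp: tensor_app_def tensors_def)

lemma tensor_app_einstein_prod:
  "tensor_app N I (einstein_prod N I A B) Z = tensor_app N I A (tensor_app N I B Z)"
proof
  fix i
  let ?S = "multi_index N I"
  show "tensor_app N I (einstein_prod N I A B) Z i = tensor_app N I A (tensor_app N I B Z) i"
  proof (cases "i \<in> ?S")
    case True
    have "(\<Sum>k\<in>?S. (\<Sum>l\<in>?S. A i l * B l k) * Z k) = (\<Sum>k\<in>?S. \<Sum>l\<in>?S. A i l * (B l k * Z k))"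
      by (simp add: sum_distrib_right mult.assoc)
    also have "\<dots> = (\<Sum>l\<in>?S. A i l * (\<Sum>k\<in>?S. B l k * Z k))"
      by (subst sum.swap) (simp add: sum_distrib_left)
    finally show ?thesis using True by (simp add: tensor_app_def)
  qed (simp add: tensor_app_def)
qed

text \<open>Translates ranges into divisibility in the monoid. Each column of \<open>A\<close> lies
  in the range of \<open>B\<close>, and the chosen preimages form the columns of
  \<open>Y\<close>.\<close>

lemma tensor_range_subset_iff:
  assumes A: "A \<in> square_tensors N I"
  shows "tensor_range N I A \<subseteq> tensor_range N I B \<longleftrightarrow>
    (\<exists>Y\<in>square_tensors N I. A = einstein_prod N I B Y)"
proof
  let ?S = "multi_index N I"
  assume sub: "tensor_range N I A \<subseteq> tensor_range N I B"
  \<comment> \<open>Standard basis tensors: applying \<open>A\<close> to \<open>e j\<close> extracts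
    column \<open>j\<close>.\<close>
  define e where "e j = (\<lambda>k\<in>?S. if k = j then 1 else 0 :: complex)" for j
  have "\<exists>Z. \<forall>i\<in>?S. A i j = (\<Sum>k\<in>?S. B i k * Z k)" if j: "j \<in> ?S" for j
  proof -
    have "e j \<in> tensors N I" by (auto simp: e_def tensors_def)
    then obtain Z where Z: "tensor_app N I A (e j) = tensor_app N I B Z"
      using sub unfolding tensor_range_def by blast
    have "A i j = (\<Sum>k\<in>?S. B i k * Z k)" if "i \<in> ?S" for i
      using fun_cong[OF Z, of i] that j
      by (simp add: tensor_app_def e_def if_distrib[of "\<lambda>x. _ * x"] cong: if_cong)
    then show ?thesis by blast
  qed
  then obtain Z where Z: "\<And>i j. i \<in> ?S \<Longrightarrow> j \<in> ?S \<Longrightarrow> A i j = (\<Sum>k\<in>?S. B i k * Z j k)"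
    by metis
  define Y where "Y = (\<lambda>k\<in>?S. \<lambda>j\<in>?S. Z j k)"
  have "A = einstein_prod N I B Y"
    using A by (rule square_tensors_eqI) (auto simp: Z Y_def)
  then show "\<exists>Y\<in>square_tensors N I. A = einstein_prod N I B Y"
    by (auto simp: Y_def)
qed (auto simp: tensor_range_def tensor_app_einstein_prod)

text \<open>The \<open>LEAST\<close> in the index has its defining property only once some positive
  exponent is known to stabilise the ranges; strong regularity provides one.\<close>

lemma tensor_ind_pow:
  assumes A: "A \<in> square_tensors N I"
  shows "\<exists>Y\<in>square_tensors N I. tensor_pow N I A (tensor_ind N I A) =
    einstein_prod N I (tensor_pow N I A (Suc (tensor_ind N I A))) Y"
proof -
  let ?P = "tensor_pow N I A"
  obtain m Q where Q: "Q \<in> square_tensors N I" "?P m = einstein_prod N I (?P (Suc m)) Q"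
    using tensor_pow_strongly_regular[OF A] by blast
  \<comment> \<open>\<open>m\<close> may be 0 while the index must be positive, so the identity is
    shifted to \<open>Suc m\<close>.\<close>
  have "?P (Suc m) = einstein_prod N I A (?P m)"
    using tensor_monoid.nat_pow_Suc2[of A N I m] A by simp
  also have "\<dots> = einstein_prod N I (einstein_prod N I A (?P (Suc m))) Q"
    by (subst Q(2)) (rule einstein_prod_assoc[symmetric])
  also have "einstein_prod N I A (?P (Suc m)) = ?P (Suc (Suc m))"
    using tensor_monoid.nat_pow_Suc2[of A N I "Suc m"] A by simp
  finally have "tensor_range N I (?P (Suc m)) \<subseteq> tensor_range N I (?P (Suc (Suc m)))"
    using Q(1) tensor_range_subset_iff[OF tensor_pow_closed] by blast
  moreover have "tensor_range N I (?P (Suc (Suc m))) \<subseteq> tensor_range N I (?P (Suc m))"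
    using A tensor_range_subset_iff[OF tensor_pow_closed] tensor_pow.simps(2) by blast
  ultimately have "tensor_range N I (?P (Suc m)) = tensor_range N I (?P (Suc m + 1))"
    unfolding Suc_eq_plus1[symmetric] by (rule subset_antisym)
  then have "\<exists>k. 0 < k \<and> tensor_range N I (?P k) = tensor_range N I (?P (k + 1))"
    by blast
  from LeastI_ex[OF this] have "tensor_range N I (?P (tensor_ind N I A)) =
      tensor_range N I (?P (Suc (tensor_ind N I A)))"
    unfolding tensor_ind_def Suc_eq_plus1 by (rule conjunct2)
  then show ?thesis
    by (intro tensor_range_subset_iff[OF tensor_pow_closed, THEN iffD1] equalityD1)
qed

text \<open>The two forms differ in the square: \<open>tensor_pow\<close> starts from
  \<open>id_tensor\<close>, which is absorbed because \<open>X\<close> is a square tensor.\<close>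

lemma core_EP_inverse_iff:
  "core_EP_inverse N I A X \<longleftrightarrow> tensor_monoid.core_EP N I (tensor_ind N I A) A X"
proof -
  have "X \<in> square_tensors N I \<Longrightarrow> tensor_pow N I X 2 = einstein_prod N I X X"
    by (simp add: numeral_2_eq_2 id_tensor_mult)
  then show ?thesis
    unfolding core_EP_inverse_def tensor_monoid.core_EP_def Let_def
      tensor_monoid_simps tensor_monoid_pow Suc_eq_plus1
    by metis
qed

theorem theorem4p1:
  fixes N k :: nat and I :: "nat \<Rightarrow> nat" and A :: tensor2
  assumes "1 \<le> N"
    and "\<And>m. m \<in> {1..N} \<Longrightarrow> 1 \<le> I m"
    and "A \<in> square_tensors N I"
    and "tensor_ind N I A = k"
  shows "\<exists>!X\<in>square_tensors N I. core_EP_inverse N I A X"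
proof -
  note core_EP_exists = tensor_monoid.core_EP_exists[unfolded tensor_monoid_simps tensor_monoid_pow]
    and core_EP_unique = tensor_monoid.core_EP_unique[unfolded tensor_monoid_simps tensor_monoid_pow]
  obtain Y where Y: "Y \<in> square_tensors N I"
    "tensor_pow N I A k = einstein_prod N I (tensor_pow N I A (Suc k)) Y"
    using tensor_ind_pow[OF assms(3)] assms(4) by blast
  obtain X where X: "core_EP_inverse N I A X"
    using core_EP_exists[OF assms(3) Y] unfolding core_EP_inverse_iff assms(4) by blast
  moreover have "X \<in> square_tensors N I"
    using X by (simp add: core_EP_inverse_def Let_def)
  moreover have "X' = X" if "core_EP_inverse N I A X'" for X'
    using core_EP_unique[OF assms(3) Y] X that unfolding core_EP_inverse_iff assms(4) by blast
  ultimately show ?thesis by blast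
qed

end
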